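(* No countable family of $C$-sets separates the functions in the space $(C(\omega^* ),\tau_p)$. That is, for every sequence $(Y_n)_{n\in\omega}$ of $C$-sets in $(C(\omega^* ),\tau_p)$ there are two distinct functions $g_1,g_2\in C(\omega^* )$ such that for every $n$, $g_1\in Y_n$ if and only if $g_2\in Y_n$.
   Context: $\omega^*=\beta\omega\setminus\omega$, where $\beta\omega$ is the Čech–Stone compactification of the discrete space $\omega$. $C(\omega^* )$ is the space of continuous real-valued functions on $\omega^*$ and $\tau_p$ is the topology of pointwise convergence. In a topological space $X$, the $C$-sets are the elements of the smallest $\sigma$-algebra in $X$ containing the open sets and closed under the Souslin operation. *)

theory Defs
  imports "HOL-Analysis.Analysis"
begin

section \<open>The Cech-Stone compactification of the discrete space of natural numbers\<close>

definition ultrafilter :: "'a filter \<Rightarrow> bool" where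
  "ultrafilter F \<longleftrightarrow> F \<noteq> bot \<and> (\<forall>P. eventually P F \<or> eventually (\<lambda>x. \<not> P x) F)"

definition basic_ultra :: "nat set \<Rightarrow> nat filter set" where
  "basic_ultra A = {F. ultrafilter F \<and> eventually (\<lambda>n. n \<in> A) F}"

text \<open>The Stone space of ultrafilters on the natural numbers; theorem
  \<open>beta_omega_Cech_Stone\<close> below states that it has the universal property of the
  Cech-Stone compactification.  The natural number \<open>n\<close> is identified with the principal
  ultrafilter at \<open>n\<close>.\<close>

definition beta_omega :: "nat filter topology" where
  "beta_omega = topology_generated_by (range basic_ultra)"

definition omega_point :: "nat \<Rightarrow> nat filter" where
  "omega_point n = principal {n}"

definition omega_star :: "nat filter topology" where
  "omega_star = subtopology beta_omega (topspace beta_omega - range omega_point)"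


section \<open>Spaces of continuous functions with the topology of pointwise convergence\<close>

text \<open>A function on \<open>topspace X\<close> is represented by its extension by \<open>undefined\<close>, which is
  what membership in the topspace of a product topology requires; so equality of
  elements of the topspace of \<open>Cp X\<close> is equality of functions on \<open>topspace X\<close>.\<close>

definition Cp :: "'a topology \<Rightarrow> ('a \<Rightarrow> real) topology" where
  "Cp X = subtopology (product_topology (\<lambda>x. euclideanreal) (topspace X))
            {f. continuous_map X euclideanreal f}"


section \<open>C-sets\<close>

definition souslin :: "(nat list \<Rightarrow> 'a set) \<Rightarrow> 'a set" where
  "souslin A = (\<Union>\<sigma>::nat \<Rightarrow> nat. \<Inter>k. A (map \<sigma> [0..<k]))"

definition C_sets :: "'a topology \<Rightarrow> 'a set set" where
  "C_sets X = \<Inter>{M. sigma_algebra (topspace X) M \<and> {U. openin X U} \<subseteq> M \<and>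
                     (\<forall>A. range A \<subseteq> M \<longrightarrow> souslin A \<in> M)}"


section \<open>Basic facts\<close>

lemma ultrafilter_not_eventually:
  assumes "ultrafilter F"
  shows "\<not> eventually P F \<longleftrightarrow> eventually (\<lambda>x. \<not> P x) F"
proof -
  have "\<not> (eventually P F \<and> eventually (\<lambda>x. \<not> P x) F)"
    using assms by (auto simp: ultrafilter_def eventually_conj_iff[symmetric])
  then show ?thesis using assms unfolding ultrafilter_def by blast
qed

lemma ultrafilter_exists:
  fixes F :: "'a filter"
  assumes "F \<noteq> bot"
  shows "\<exists>G\<le>F. ultrafilter G"
proof -
  let ?S = "{G. G \<le> F \<and> G \<noteq> bot}"
  have po: "partial_order_on ?S (relation_of (\<ge>) ?S)"
    by (auto simp: partial_order_on_def preorder_on_def refl_on_def trans_def antisym_def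
          relation_of_def)
  have ub: "\<exists>u\<in>?S. \<forall>a\<in>C. u \<le> a" if C: "C \<in> Chains (relation_of (\<ge>) ?S)" for C
  proof (cases "C = {}")
    case True
    then show ?thesis using assms by auto
  next
    case False
    have CS: "C \<subseteq> ?S" and lin: "\<And>a b. a \<in> C \<Longrightarrow> b \<in> C \<Longrightarrow> a \<le> b \<or> b \<le> a"
      using C by (auto simp: Chains_def relation_of_def)
    have ev: "eventually P (Inf C) \<longleftrightarrow> (\<exists>b\<in>C. eventually P b)" for P
      by (rule eventually_Inf_base[OF False]) (metis inf.absorb1 inf.absorb2 lin)
    have "Inf C \<noteq> bot"
      using CS ev[of "\<lambda>_. False"] by (auto simp: trivial_limit_def[symmetric])
    moreover have "Inf C \<le> F"
      using False CS by (metis (no_types, lifting) Inf_lower2 equals0I mem_Collect_eq subsetD)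
    ultimately show ?thesis by (auto intro: Inf_lower)
  qed
  obtain G where G: "G \<in> ?S" and maxG: "\<And>H. H \<in> ?S \<Longrightarrow> H \<le> G \<Longrightarrow> H = G"
    using predicate_Zorn[OF po ub] by auto
  have "eventually P G \<or> eventually (\<lambda>x. \<not> P x) G" for P
  proof (cases "inf G (principal {x. P x}) = bot")
    case True
    then have "eventually (\<lambda>x. False) (inf G (principal {x. P x}))" by simp
    then show ?thesis by (simp add: eventually_inf_principal)
  next
    case False
    then have "inf G (principal {x. P x}) = G"
      using maxG[of "inf G (principal {x. P x})"] G by (auto intro: le_infI1)
    then have "G \<le> principal {x. P x}" by (metis inf.cobounded2)
    then show ?thesis by (simp add: le_principal)
  qed
  then show ?thesis using G by (auto simp: ultrafilter_def)
qed

lemma ultrafilter_omega_point: "ultrafilter (omega_point n)"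
  by (simp add: ultrafilter_def omega_point_def eventually_principal principal_eq_bot_iff)

lemma inj_omega_point: "inj omega_point"
  by (auto simp: inj_def omega_point_def)

lemma basic_ultra_Int: "basic_ultra A \<inter> basic_ultra B = basic_ultra (A \<inter> B)"
  by (auto simp: basic_ultra_def eventually_conj_iff)

lemma topspace_beta_omega: "topspace beta_omega = {F. ultrafilter F}"
  by (auto simp: beta_omega_def basic_ultra_def intro!: exI[of _ UNIV])

lemma openin_basic_ultra: "openin beta_omega (basic_ultra A)"
  unfolding beta_omega_def by (simp add: topology_generated_by_Basis)

lemma openin_beta_omega:
  "openin beta_omega U \<longleftrightarrow>
     (\<forall>F\<in>U. ultrafilter F \<and> (\<exists>A. F \<in> basic_ultra A \<and> basic_ultra A \<subseteq> U))"
proof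
  assume U: "openin beta_omega U"
  then have "generate_topology_on (range basic_ultra) U"
    by (simp add: beta_omega_def openin_topology_generated_by_iff)
  then have "\<forall>F\<in>U. \<exists>A. F \<in> basic_ultra A \<and> basic_ultra A \<subseteq> U"
  proof induction
    case (Int a b)
    show ?case
    proof
      fix F assume "F \<in> a \<inter> b"
      with Int.IH obtain A B where "F \<in> basic_ultra A" "basic_ultra A \<subseteq> a"
        "F \<in> basic_ultra B" "basic_ultra B \<subseteq> b" by blast
      then show "\<exists>A. F \<in> basic_ultra A \<and> basic_ultra A \<subseteq> a \<inter> b"
        using basic_ultra_Int[of A B] by (intro exI[of _ "A \<inter> B"]) blast
    qed
  next
    case (UN K)
    then show ?case by (meson Union_iff Union_upper subset_trans)
  qed auto
  moreover have "U \<subseteq> {F. ultrafilter F}"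
    using openin_subset[OF U] by (simp add: topspace_beta_omega)
  ultimately show "\<forall>F\<in>U. ultrafilter F \<and> (\<exists>A. F \<in> basic_ultra A \<and> basic_ultra A \<subseteq> U)"
    by blast
next
  assume "\<forall>F\<in>U. ultrafilter F \<and> (\<exists>A. F \<in> basic_ultra A \<and> basic_ultra A \<subseteq> U)"
  then show "openin beta_omega U"
    by (subst openin_subopen) (meson openin_basic_ultra)
qed

lemma Hausdorff_beta_omega: "Hausdorff_space beta_omega"
  unfolding Hausdorff_space_def topspace_beta_omega
proof (intro allI impI, clarsimp)
  fix F G :: "nat filter"
  assume F: "ultrafilter F" and G: "ultrafilter G" and ne: "F \<noteq> G"
  obtain P where P: "eventually P F" "eventually (\<lambda>x. \<not> P x) G"
    using F G ne by (metis filter_eq_iff ultrafilter_not_eventually)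
  have disj: "basic_ultra {x. P x} \<inter> basic_ultra {x. \<not> P x} = {}"
    by (auto simp: basic_ultra_def ultrafilter_not_eventually[symmetric])
  have "F \<in> basic_ultra {x. P x}" "G \<in> basic_ultra {x. \<not> P x}"
    using P F G by (auto simp: basic_ultra_def)
  then show "\<exists>U. openin beta_omega U \<and> (\<exists>V. openin beta_omega V \<and> F \<in> U \<and> G \<in> V \<and> disjnt U V)"
    using disj openin_basic_ultra unfolding disjnt_def by blast
qed

lemma compact_beta_omega: "compact_space beta_omega"
  unfolding compact_space_alt
proof (intro allI impI, elim conjE)
  fix \<U>
  assume op: "\<forall>U\<in>\<U>. openin beta_omega U" and cov: "topspace beta_omega \<subseteq> \<Union>\<U>"
  define \<A> where "\<A> = {A. \<exists>U\<in>\<U>. basic_ultra A \<subseteq> U}"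
  define F where "F = (INF A\<in>\<A>. principal (- A))"
  have "F = bot"
  proof (rule ccontr)
    assume "F \<noteq> bot"
    then obtain G where G: "G \<le> F" "ultrafilter G" using ultrafilter_exists by blast
    then obtain U where U: "U \<in> \<U>" "G \<in> U" using cov by (auto simp: topspace_beta_omega)
    then obtain A where A: "G \<in> basic_ultra A" "basic_ultra A \<subseteq> U"
      using op by (meson openin_beta_omega)
    have "G \<le> principal (- A)"
      using G(1) A(2) U(1) unfolding F_def \<A>_def by (auto simp: le_INF_iff)
    then have "eventually (\<lambda>n. n \<notin> A) G" by (simp add: le_principal)
    then show False using A(1) ultrafilter_not_eventually[OF G(2)] by (auto simp: basic_ultra_def)
  qed
  then have "eventually (\<lambda>x. False) F" by simp
  then obtain X where X: "X \<subseteq> \<A>" "finite X" "eventually (\<lambda>x. False) (INF A\<in>X. principal (- A))"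
    unfolding F_def by (blast dest: iffD1[OF eventually_INF])
  have "(INF A\<in>X. principal (- A)) = principal (\<Inter>A\<in>X. - A)"
    using X(2) by (rule INF_principal_finite)
  then have "eventually (\<lambda>x. False) (principal (\<Inter>A\<in>X. - A))" using X(3) by simp
  then have cX: "\<Union>X = UNIV" unfolding eventually_principal by blast
  have "\<forall>A\<in>X. \<exists>U. U \<in> \<U> \<and> basic_ultra A \<subseteq> U"
    using X(1) unfolding \<A>_def by blast
  then obtain u where "\<forall>A\<in>X. u A \<in> \<U> \<and> basic_ultra A \<subseteq> u A"
    by (rule bchoice[THEN exE])
  then have u: "u A \<in> \<U>" "basic_ultra A \<subseteq> u A" if "A \<in> X" for A
    using that by blast+
  have "topspace beta_omega \<subseteq> \<Union>(u ` X)"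
  proof
    fix G assume "G \<in> topspace beta_omega"
    then have G: "ultrafilter G" by (simp add: topspace_beta_omega)
    have "\<exists>A\<in>X. eventually (\<lambda>n. n \<in> A) G"
    proof (rule ccontr)
      assume "\<not> ?thesis"
      then have "\<forall>A\<in>X. eventually (\<lambda>n. n \<notin> A) G" using ultrafilter_not_eventually[OF G] by blast
      then have "eventually (\<lambda>n. \<forall>A\<in>X. n \<notin> A) G" using X(2) by (simp add: eventually_ball_finite)
      then have "eventually (\<lambda>n. False) G" by eventually_elim (use cX in blast)
      then show False using G by (simp add: ultrafilter_def)
    qed
    then obtain A where "A \<in> X" "G \<in> basic_ultra A" using G by (auto simp: basic_ultra_def)
    then show "G \<in> \<Union>(u ` X)" using u(2) by blast
  qed
  then show "\<exists>\<F>. finite \<F> \<and> \<F> \<subseteq> \<U> \<and> topspace beta_omega \<subseteq> \<Union>\<F>"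
    using X(2) u by (intro exI[of _ "u ` X"]) auto
qed

lemma embedding_omega_point:
  "embedding_map (discrete_topology UNIV) beta_omega omega_point"
proof (rule injective_open_imp_embedding_map)
  show "continuous_map (discrete_topology UNIV) beta_omega omega_point"
    by (auto simp: continuous_map_from_discrete_topology topspace_beta_omega ultrafilter_omega_point)
  show "open_map (discrete_topology UNIV) beta_omega omega_point"
    unfolding open_map_def
  proof (intro allI impI)
    fix A :: "nat set"
    have "basic_ultra {n} = {omega_point n}" for n
    proof (intro equalityI subsetI)
      fix F assume "F \<in> basic_ultra {n}"
      then have n: "eventually (\<lambda>x. x = n) F" and F: "ultrafilter F"
        by (auto simp: basic_ultra_def)
      have imp: "eventually P F" if "P n" for P
        using n by eventually_elim (use that in simp)
      have "eventually P F \<longleftrightarrow> P n" for P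
        using imp[of P] imp[of "\<lambda>x. \<not> P x"] ultrafilter_not_eventually[OF F, of P] by blast
      then show "F \<in> {omega_point n}"
        by (simp add: filter_eq_iff omega_point_def eventually_principal)
    next
      fix F assume "F \<in> {omega_point n}"
      then show "F \<in> basic_ultra {n}"
        using ultrafilter_omega_point[of n]
        by (simp add: basic_ultra_def omega_point_def eventually_principal)
    qed
    then have "omega_point ` A = (\<Union>n\<in>A. basic_ultra {n})" by auto
    then show "openin beta_omega (omega_point ` A)" by (auto intro: openin_basic_ultra)
  qed
qed (simp add: inj_omega_point)

lemma dense_omega_point: "beta_omega closure_of (range omega_point) = topspace beta_omega"
proof -
  have "\<exists>y. y \<in> range omega_point \<and> y \<in> T" if F: "F \<in> T" and T: "openin beta_omega T" for F T
  proof -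
    obtain A where A: "F \<in> basic_ultra A" "basic_ultra A \<subseteq> T"
      using F T by (meson openin_beta_omega)
    then have "A \<noteq> {}" by (auto simp: basic_ultra_def ultrafilter_def)
    then obtain n where "n \<in> A" by blast
    then have "omega_point n \<in> basic_ultra A"
      using ultrafilter_omega_point[of n] by (simp add: basic_ultra_def omega_point_def eventually_principal)
    then show ?thesis using A(2) by blast
  qed
  then show ?thesis by (fastforce simp: closure_of_def)
qed

lemma extend_to_beta_omega:
  fixes f :: "nat \<Rightarrow> 'b"
  assumes Z: "compact_space Z" "Hausdorff_space Z" and f: "range f \<subseteq> topspace Z"
  shows "\<exists>g. continuous_map beta_omega Z g \<and> (\<forall>n. g (omega_point n) = f n)"
proof -
  have ex: "\<exists>l. limitin Z f l F" if F: "ultrafilter F" for F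
  proof (rule ccontr)
    assume no: "\<not> ?thesis"
    have "\<forall>l\<in>topspace Z. \<exists>U. openin Z U \<and> l \<in> U \<and> eventually (\<lambda>n. f n \<notin> U) F"
      using no ultrafilter_not_eventually[OF F] unfolding limitin_def by blast
    then obtain U where U: "\<And>l. l \<in> topspace Z \<Longrightarrow>
        openin Z (U l) \<and> l \<in> U l \<and> eventually (\<lambda>n. f n \<notin> U l) F" by metis
    have "(\<forall>V\<in>U ` topspace Z. openin Z V) \<and> topspace Z \<subseteq> \<Union>(U ` topspace Z)"
      using U by auto
    then have "\<exists>\<F>. finite \<F> \<and> \<F> \<subseteq> U ` topspace Z \<and> topspace Z \<subseteq> \<Union>\<F>"
      using Z(1) unfolding compact_space_alt by simp
    then obtain \<F> where \<F>: "finite \<F>" "\<F> \<subseteq> U ` topspace Z" "topspace Z \<subseteq> \<Union>\<F>" by blast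
    have "\<forall>V\<in>\<F>. eventually (\<lambda>n. f n \<notin> V) F" using U \<F>(2) by blast
    then have "eventually (\<lambda>n. \<forall>V\<in>\<F>. f n \<notin> V) F" using \<F>(1) by (simp add: eventually_ball_finite)
    then have "eventually (\<lambda>n. False) F" by eventually_elim (use f \<F>(3) in blast)
    then show False using F by (simp add: ultrafilter_def)
  qed
  then obtain g where g: "\<And>F. ultrafilter F \<Longrightarrow> limitin Z f (g F) F" by metis
  have "continuous_map beta_omega Z g"
    unfolding continuous_map
  proof (intro conjI allI impI)
    show "g ` topspace beta_omega \<subseteq> topspace Z"
      using g by (auto simp: topspace_beta_omega limitin_def)
    fix W assume W: "openin Z W"
    show "openin beta_omega {F \<in> topspace beta_omega. g F \<in> W}"
      unfolding openin_beta_omega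
    proof (intro ballI)
      fix F assume "F \<in> {F \<in> topspace beta_omega. g F \<in> W}"
      then have F: "ultrafilter F" and gF: "g F \<in> W" by (auto simp: topspace_beta_omega)
      have "regular_space Z" using Z by (simp add: compact_Hausdorff_imp_regular_space)
      then obtain V C where VC: "openin Z V" "closedin Z C" "g F \<in> V" "V \<subseteq> C" "C \<subseteq> W"
        using W gF unfolding neighbourhood_base_of_closedin[symmetric] neighbourhood_base_of by meson
      define A where "A = {n. f n \<in> V}"
      have FA: "F \<in> basic_ultra A"
        using g[OF F] VC F by (auto simp: limitin_def basic_ultra_def A_def)
      have "g G \<in> W" if G: "G \<in> basic_ultra A" for G
      proof -
        have uG: "ultrafilter G" and "eventually (\<lambda>n. f n \<in> V) G"
          using G by (auto simp: basic_ultra_def A_def)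
        then have "eventually (\<lambda>n. f n \<in> C) G"
          using VC(4) by (auto elim: eventually_mono)
        then have "g G \<in> C"
          using limitin_closedin[OF g[OF uG] VC(2)] uG by (simp add: ultrafilter_def)
        then show ?thesis using VC by blast
      qed
      then show "ultrafilter F \<and>
          (\<exists>A. F \<in> basic_ultra A \<and> basic_ultra A \<subseteq> {F \<in> topspace beta_omega. g F \<in> W})"
        using F FA by (auto simp: topspace_beta_omega basic_ultra_def)
    qed
  qed
  moreover have "g (omega_point n) = f n" for n
  proof -
    have "limitin Z f (f n) (omega_point n)"
      using f by (auto simp: limitin_def omega_point_def eventually_principal)
    moreover have "omega_point n \<noteq> bot"
      using ultrafilter_omega_point[of n] by (simp add: ultrafilter_def)
    ultimately show ?thesis
      using limitin_Hausdorff_unique[OF g[OF ultrafilter_omega_point] _ _ Z(2)] by blast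
  qed
  ultimately show ?thesis by blast
qed

theorem beta_omega_Cech_Stone:
  "compact_space beta_omega" "Hausdorff_space beta_omega"
  "embedding_map (discrete_topology UNIV) beta_omega omega_point"
  "beta_omega closure_of (range omega_point) = topspace beta_omega"
  "\<lbrakk>compact_space Z; Hausdorff_space Z; continuous_map (discrete_topology UNIV) Z f\<rbrakk>
     \<Longrightarrow> \<exists>g. continuous_map beta_omega Z g \<and> (\<forall>n. g (omega_point n) = f n)"
proof -
  assume Z: "compact_space Z" "Hausdorff_space Z"
    and f: "continuous_map (discrete_topology UNIV) Z f"
  have "range f \<subseteq> topspace Z" using continuous_map_image_subset_topspace[OF f] by simp
  then show "\<exists>g. continuous_map beta_omega Z g \<and> (\<forall>n. g (omega_point n) = f n)"
    by (rule extend_to_beta_omega[OF Z])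
qed (fact compact_beta_omega Hausdorff_beta_omega embedding_omega_point dense_omega_point)+

lemma topspace_Cp:
  "topspace (Cp X) = {f \<in> extensional (topspace X). continuous_map X euclideanreal f}"
  by (auto simp: Cp_def PiE_UNIV_domain PiE_def)

lemma sigma_algebra_C_sets: "sigma_algebra (topspace X) (C_sets X)"
proof -
  let ?K = "{M. sigma_algebra (topspace X) M \<and> {U. openin X U} \<subseteq> M \<and>
               (\<forall>A. range A \<subseteq> M \<longrightarrow> souslin A \<in> M)}"
  have "souslin A \<in> Pow (topspace X)" if "range A \<subseteq> Pow (topspace X)" for A
  proof -
    have "A (map \<sigma> [0..<0]) \<subseteq> topspace X" for \<sigma> using that by blast
    then show ?thesis unfolding souslin_def by blast
  qed
  then have Pow: "Pow (topspace X) \<in> ?K"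
    using openin_subset[of X] by (simp add: sigma_algebra_Pow image_subset_iff) blast
  have K: "M \<subseteq> Pow (topspace X)" "{} \<in> M" "\<And>s. s \<in> M \<Longrightarrow> topspace X - s \<in> M"
    "\<And>A::nat \<Rightarrow> 'a set. range A \<subseteq> M \<Longrightarrow> \<Union>(range A) \<in> M" if "M \<in> ?K" for M
    using that by (auto simp: sigma_algebra_iff2)
  show ?thesis
    unfolding C_sets_def
  proof (rule iffD2[OF sigma_algebra_iff2], intro conjI ballI allI impI)
    show "\<Inter>?K \<subseteq> Pow (topspace X)" using Pow by (rule Inter_lower)
    show "{} \<in> \<Inter>?K" using K(2) by blast
    show "topspace X - s \<in> \<Inter>?K" if "s \<in> \<Inter>?K" for s using K(3) that by blast
    show "\<Union>(range A) \<in> \<Inter>?K" if "range A \<subseteq> \<Inter>?K" for A :: "nat \<Rightarrow> 'a set"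
    proof (rule InterI)
      fix M assume M: "M \<in> ?K"
      then have "range A \<subseteq> M" using that by (meson Inter_lower subset_trans)
      then show "\<Union>(range A) \<in> M" by (rule K(4)[OF M])
    qed
  qed
qed

lemma openin_in_C_sets: "openin X U \<Longrightarrow> U \<in> C_sets X"
  unfolding C_sets_def by blast

lemma souslin_in_C_sets: "range A \<subseteq> C_sets X \<Longrightarrow> souslin A \<in> C_sets X"
  unfolding C_sets_def by blast

end

theory Submission
  imports Defs
begin

text \<open>Pull everything back along \<open>D \<mapsto> 1\<^bsub>D*\<^esub>\<close> from subsets of \<open>\<omega>\<close> to clopen indicators, and consider
  conditions \<open>(A, C)\<close> with co-infinite \<open>A\<close>, standing for the sets \<open>D\<close> that agree with \<open>C\<close> on \<open>A\<close>
  modulo finite sets.  Every condition has a stronger one that decides membership in a given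
  pointwise open set, since finitely many ultrafilters leave an infinite part of \<open>- A\<close> untouched.
  Conditions are \<open>\<sigma>\<close>-closed, so countably many such sets are decided by a single condition;
  therefore any set whose membership depends only on countably many decided sets is decided as well,
  which covers all C-sets.  A condition deciding all \<open>Y n\<close> still leaves the values on \<open>- A\<close> free.\<close>

section \<open>Conditions and the families they decide\<close>

definition cylinder :: "nat set \<Rightarrow> nat set \<Rightarrow> nat set set" where
  "cylinder A C = {D. finite (sym_diff D C \<inter> A)}"

definition decides :: "nat set \<Rightarrow> nat set \<Rightarrow> nat set set \<Rightarrow> bool" where
  "decides A C S \<longleftrightarrow> cylinder A C \<subseteq> S \<or> cylinder A C \<inter> S = {}"

text \<open>Density of the deciding conditions: a condition grows stronger by fixing more
  coordinates, without changing anything on \<open>A\<close>, while infinitely many stay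
  free.\<close>

definition decidable :: "nat set set \<Rightarrow> bool" where
  "decidable S \<longleftrightarrow> (\<forall>A C. infinite (- A) \<longrightarrow>
     (\<exists>A' C'. A \<subseteq> A' \<and> infinite (- A') \<and> C' \<inter> A = C \<inter> A \<and> decides A' C' S))"

text \<open>Cylinders ignore finite errors, so \<open>A'\<close> may miss finitely many points of
  \<open>A\<close>; the fusion below relies on this slack.\<close>

lemma cylinder_mono:
  assumes "finite (A - A')" "C' \<inter> A = C \<inter> A"
  shows "cylinder A' C' \<subseteq> cylinder A C"
proof
  fix D assume "D \<in> cylinder A' C'"
  then have "finite ((A - A') \<union> (sym_diff D C' \<inter> A'))"
    using assms(1) by (simp add: cylinder_def)
  moreover have "sym_diff D C \<inter> A \<subseteq> (A - A') \<union> (sym_diff D C' \<inter> A')"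
    using assms(2) by blast
  ultimately show "D \<in> cylinder A C"
    unfolding cylinder_def by (blast intro: finite_subset)
qed

lemma decides_mono:
  assumes "decides A C S" "finite (A - A')" "C' \<inter> A = C \<inter> A"
  shows "decides A' C' S"
  using assms(1) cylinder_mono[OF assms(2,3)] unfolding decides_def by blast

text \<open>Fusion. The growing domains could exhaust the natural numbers, so each stage reserves a
  point outside its domain and the reserved points are removed from the union. Each domain loses
  only finitely many points this way.\<close>

lemma decidable_sequence:
  assumes S: "\<And>n::nat. decidable (S n)" and A: "infinite (- A)"
  shows "\<exists>A' C'. A \<subseteq> A' \<and> infinite (- A') \<and> C' \<inter> A = C \<inter> A \<and> (\<forall>n. decides A' C' (S n))"
proof -
  \<comment> \<open>A stage is a domain \<open>B\<close>, a prescription \<open>E\<close> and a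
    reserved point \<open>r\<close> outside \<open>B\<close>. Strict growth of \<open>r\<close>
    makes the reserved points infinite in number.\<close>
  define P where "P = (\<lambda>n::nat. \<lambda>(B, E::nat set, r::nat).
    infinite (- B) \<and> r \<notin> B \<and> A \<subseteq> B \<and> E \<inter> A = C \<inter> A)"
  define Q where "Q = (\<lambda>n. \<lambda>(B, E, r::nat). \<lambda>(B', E', r').
    B \<subseteq> B' \<and> E' \<inter> B = E \<inter> B \<and> r < r' \<and> decides B' E' (S n))"
  have "\<exists>f. \<forall>n. P n (f n) \<and> Q n (f n) (f (Suc n))"
  proof (rule dependent_nat_choice)
    obtain r where "r \<in> - A" using A by (metis finite.emptyI ex_in_conv)
    then show "\<exists>x. P 0 x"
      using A by (intro exI[of _ "(A, C, r)"]) (auto simp: P_def)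
  next
    fix x n assume "P n x"
    then obtain B E r where x: "x = (B, E, r)" and B: "infinite (- B)" "A \<subseteq> B" "E \<inter> A = C \<inter> A"
      by (auto simp: P_def)
    obtain B' E' where E: "B \<subseteq> B'" "infinite (- B')" "E' \<inter> B = E \<inter> B" "decides B' E' (S n)"
      using S[unfolded decidable_def, rule_format, OF B(1)] by metis
    obtain r' where "r < r'" "r' \<in> - B'"
      using E(2) infinite_nat_iff_unbounded by blast
    moreover have "E' \<inter> A = C \<inter> A" using E(3) B by blast
    ultimately show "\<exists>y. P (Suc n) y \<and> Q n x y"
      using E B(2) by (intro exI[of _ "(B', E', r')"]) (auto simp: P_def Q_def x)
  qed
  then obtain f where f: "\<And>n. P n (f n)" "\<And>n. Q n (f n) (f (Suc n))" by blast
  define B where "B n = fst (f n)" for n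
  define E where "E n = fst (snd (f n))" for n
  define r where "r n = snd (snd (f n))" for n
  have P: "r n \<notin> B n" "A \<subseteq> B n" "E n \<inter> A = C \<inter> A" for n
    using f(1)[of n] by (auto simp: P_def B_def E_def r_def split: prod.splits)
  have Q: "B n \<subseteq> B (Suc n)" "E (Suc n) \<inter> B n = E n \<inter> B n" "r n < r (Suc n)"
    "decides (B (Suc n)) (E (Suc n)) (S n)" for n
    using f(2)[of n] by (auto simp: Q_def B_def E_def r_def split: prod.splits)
  have Bmono: "B m \<subseteq> B n" if "m \<le> n" for m n
    using Q(1) that by (rule lift_Suc_mono_le)
  have Eeq: "E n \<inter> B m = E m \<inter> B m" if "m \<le> n" for m n
    using that
  proof (induction rule: dec_induct)
    case (step n)
    then show ?case using Q(2)[of n] Bmono[of m n] by blast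
  qed simp
  define A' where "A' = (\<Union>n. B n) - range r"
  define C' where "C' = (\<Union>n. E n \<inter> B n)"
  have C': "C' \<inter> B n = E n \<inter> B n" for n
  proof (intro equalityI subsetI)
    fix x assume "x \<in> C' \<inter> B n"
    then obtain m where m: "x \<in> E m" "x \<in> B m" "x \<in> B n" by (auto simp: C'_def)
    then show "x \<in> E n \<inter> B n"
      using Eeq[of m n] Eeq[of n m] by (cases "m \<le> n") auto
  qed (auto simp: C'_def)
  have "strict_mono r" using Q(3) by (simp add: strict_mono_Suc_iff)
  then have "infinite (range r)"
    using range_inj_infinite strict_mono_imp_inj_on by blast
  then have inf: "infinite (- A')"
    by (rule contrapos_nn) (auto simp: A'_def intro: finite_subset)
  \<comment> \<open>For \<open>k \<ge> n\<close> the point \<open>r k\<close> is outside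
    \<open>B k\<close>, hence outside \<open>B n\<close>; only the first \<open>n\<close> reserved
    points can be lost.\<close>
  have fin: "finite (B n - A')" for n
  proof (rule finite_subset)
    show "B n - A' \<subseteq> r ` {..<n}"
    proof
      fix x assume "x \<in> B n - A'"
      then obtain k where k: "x = r k" "r k \<in> B n" by (auto simp: A'_def)
      then have "k < n" using P(1)[of k] Bmono[of n k] by (meson not_le subsetD)
      then show "x \<in> r ` {..<n}" using k by blast
    qed
  qed simp
  \<comment> \<open>Since \<open>A\<close> lies in every \<open>B k\<close>, it loses nothing, and
    its inclusion in \<open>A'\<close> is exact.\<close>
  have "r k \<notin> A" for k using P(1,2)[of k] by blast
  then have "A \<subseteq> A'" using P(2)[of 0] by (auto simp: A'_def)
  moreover have "C' \<inter> A = C \<inter> A" using C'[of 0] P(2,3)[of 0] by blast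
  \<comment> \<open>\<open>S n\<close> is decided at stage \<open>Suc n\<close>, which the limit
    refines up to a finite set.\<close>
  moreover have "decides A' C' (S n)" for n
    using Q(4) fin C' by (rule decides_mono)
  ultimately show ?thesis using inf by blast
qed

text \<open>On the cylinder of a condition deciding every \<open>S n\<close>, membership in each
  \<open>S n\<close> is constant, so \<open>T\<close> cannot split it. Complements, countable unions
  and the Souslin operation are all instances.\<close>

lemma decidable_combination:
  assumes S: "\<And>n::nat. decidable (S n)"
    and T: "\<And>D D'. (\<And>n. D \<in> S n \<longleftrightarrow> D' \<in> S n) \<Longrightarrow> D \<in> T \<longleftrightarrow> D' \<in> T"
  shows "decidable T"
  unfolding decidable_def
proof (intro allI impI)
  fix A C :: "nat set" assume A: "infinite (- A)"
  obtain A' C' where *: "A \<subseteq> A'" "infinite (- A')" "C' \<inter> A = C \<inter> A"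
    and d: "\<And>n. decides A' C' (S n)"
    using decidable_sequence[of S, OF S A, of C] by auto
  have "D \<in> T \<longleftrightarrow> D' \<in> T" if "D \<in> cylinder A' C'" "D' \<in> cylinder A' C'" for D D'
    using d that by (intro T) (auto simp: decides_def)
  then have "decides A' C' T" unfolding decides_def by blast
  with * show "\<exists>A' C'. A \<subseteq> A' \<and> infinite (- A') \<and> C' \<inter> A = C \<inter> A \<and> decides A' C' T"
    by blast
qed

section \<open>Clopen indicators on the remainder\<close>

lemma topspace_omega_star: "topspace omega_star = {F. ultrafilter F} - range omega_point"
  by (auto simp: omega_star_def topspace_beta_omega)

text \<open>\<open>restrict\<close> supplies the value \<open>undefined\<close> off the space, as
  membership in \<open>topspace (Cp omega_star)\<close> demands.\<close>

definition star_indicator :: "nat set \<Rightarrow> nat filter \<Rightarrow> real" where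
  "star_indicator D = restrict (indicator (basic_ultra D)) (topspace omega_star)"

lemma star_indicator_eq_iff:
  assumes "F \<in> topspace omega_star"
  shows "star_indicator D F = star_indicator D' F \<longleftrightarrow>
    (eventually (\<lambda>n. n \<in> D) F \<longleftrightarrow> eventually (\<lambda>n. n \<in> D') F)"
  using assms
  by (auto simp: star_indicator_def topspace_omega_star basic_ultra_def indicator_def)

lemma continuous_star_indicator: "continuous_map omega_star euclideanreal (star_indicator D)"
proof -
  \<comment> \<open>The preimage of \<open>U\<close> depends only on whether \<open>U\<close>
    contains 0 and 1, and \<open>basic_ultra D\<close> and \<open>basic_ultra (- D)\<close> are
    complementary open sets.\<close>
  have *: "{F \<in> topspace beta_omega. (indicator (basic_ultra D) F :: real) \<in> U} =
      (if 1 \<in> U then basic_ultra D else {}) \<union> (if 0 \<in> U then basic_ultra (- D) else {})" for U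
    by (auto simp: topspace_beta_omega basic_ultra_def indicator_def ultrafilter_not_eventually
      split: if_splits) (auto simp: ultrafilter_not_eventually[symmetric])
  have "continuous_map beta_omega euclideanreal (indicator (basic_ultra D))"
    unfolding continuous_map * by (auto intro: openin_basic_ultra)
  then have "continuous_map omega_star euclideanreal (indicator (basic_ultra D))"
    unfolding omega_star_def by (rule continuous_map_from_subtopology)
  then show ?thesis
    by (rule continuous_map_eq) (simp add: star_indicator_def)
qed

lemma star_indicator_in_Cp: "star_indicator D \<in> topspace (Cp omega_star)"
  by (simp add: topspace_Cp continuous_star_indicator) (simp add: star_indicator_def)

section \<open>Decidability of open sets and of C-sets\<close>

text \<open>A basic open box in the product constrains only finitely many coordinates; these form
  \<open>K\<close>.\<close>

lemma openin_Cp_finite_support: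
  assumes "openin (Cp X) U" "g \<in> U"
  shows "\<exists>K \<subseteq> topspace X. finite K \<and> (\<forall>h \<in> topspace (Cp X). (\<forall>x\<in>K. h x = g x) \<longrightarrow> h \<in> U)"
proof -
  obtain V where V: "openin (product_topology (\<lambda>x. euclideanreal) (topspace X)) V"
    and U: "U = V \<inter> {f. continuous_map X euclideanreal f}"
    using assms(1) by (auto simp: Cp_def openin_subtopology)
  obtain W where W: "finite {i \<in> topspace X. W i \<noteq> UNIV}"
    "g \<in> Pi\<^sub>E (topspace X) W" "Pi\<^sub>E (topspace X) W \<subseteq> V"
    using V assms(2) by (auto simp: U openin_product_topology_alt)
  have "h \<in> U" if h: "h \<in> topspace (Cp X)" "\<forall>x\<in>{i \<in> topspace X. W i \<noteq> UNIV}. h x = g x" for h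
  proof -
    have "h i \<in> W i" if "i \<in> topspace X" for i
      using W(2) h(2) that by (cases "W i = UNIV") (auto simp: PiE_iff)
    then have "h \<in> Pi\<^sub>E (topspace X) W"
      using h(1) by (simp add: topspace_Cp PiE_iff)
    then show ?thesis using W(3) h(1) unfolding U by (auto simp: topspace_Cp)
  qed
  then show ?thesis using W(1) by (intro exI[of _ "{i \<in> topspace X. W i \<noteq> UNIV}"]) auto
qed

text \<open>Of pairwise disjoint sets an ultrafilter contains at most one. Splitting the current set
  into infinitely many infinite pieces leaves one that the next ultrafilter omits.\<close>

lemma infinite_subset_avoiding_ultrafilters:
  fixes R :: "'a set"
  assumes "finite K" "\<And>F. F \<in> K \<Longrightarrow> ultrafilter F" "infinite R"
  shows "\<exists>R' \<subseteq> R. infinite R' \<and> (\<forall>F\<in>K. eventually (\<lambda>x. x \<notin> R') F)"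
  using assms(1,2)
proof (induction K rule: finite_induct)
  case empty
  show ?case using assms(3) by blast
next
  case (insert F K)
  then obtain R' where R': "R' \<subseteq> R" "infinite R'" "\<And>G. G \<in> K \<Longrightarrow> eventually (\<lambda>x. x \<notin> R') G"
    by auto
  obtain P :: "nat \<Rightarrow> 'a set" where
    P: "pairwise (\<lambda>i j. disjnt (P i) (P j)) UNIV" "\<And>i. P i \<subseteq> R'" "\<And>i. infinite (P i)"
    by (rule infinite_infinite_partition[OF R'(2)]) blast
  have F: "ultrafilter F" using insert.prems by blast
  have "\<exists>i. eventually (\<lambda>x. x \<notin> P i) F"
  proof (rule ccontr)
    assume "\<not> ?thesis"
    then have "eventually (\<lambda>x. x \<in> P 0) F" "eventually (\<lambda>x. x \<in> P 1) F"
      using ultrafilter_not_eventually[OF F] by (metis (mono_tags, lifting) eventually_mono)+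
    then have "eventually (\<lambda>x. False) F"
      by eventually_elim (use P(1) in \<open>auto simp: pairwise_def disjnt_def\<close>)
    then show False using F by (simp add: ultrafilter_def)
  qed
  then obtain i where "eventually (\<lambda>x. x \<notin> P i) F" by blast
  moreover have "eventually (\<lambda>x. x \<notin> P i) G" if "G \<in> K" for G
    using R'(3)[OF that] by eventually_elim (use P(2) in blast)
  moreover have "P i \<subseteq> R" using P(2) R'(1) by blast
  ultimately show ?case using P(3) by (intro exI[of _ "P i"]) simp
qed

text \<open>If some \<open>D\<close> in the cylinder has its indicator in \<open>U\<close>, finitely
  many values of that indicator guarantee this. Fixing \<open>D\<close> outside an infinite set
  \<open>R\<close> omitted by the ultrafilters concerned freezes those values.\<close>

lemma decidable_open:
  assumes U: "openin (Cp omega_star) U"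
  shows "decidable (star_indicator -` U)"
  unfolding decidable_def
proof (intro allI impI)
  fix A C :: "nat set" assume A: "infinite (- A)"
  show "\<exists>A' C'. A \<subseteq> A' \<and> infinite (- A') \<and> C' \<inter> A = C \<inter> A \<and> decides A' C' (star_indicator -` U)"
  proof (cases "cylinder A C \<inter> star_indicator -` U = {}")
    case True
    then show ?thesis using A by (auto simp: decides_def)
  next
    case False
    then obtain D where D: "D \<in> cylinder A C" "star_indicator D \<in> U" by blast
    obtain K where K: "K \<subseteq> topspace omega_star" "finite K"
      "\<forall>h\<in>topspace (Cp omega_star). (\<forall>x\<in>K. h x = star_indicator D x) \<longrightarrow> h \<in> U"
      using openin_Cp_finite_support[OF U, of "star_indicator D"] D(2) by auto
    have "ultrafilter F" if "F \<in> K" for F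
      using K(1) that by (auto simp: topspace_omega_star)
    then obtain R where R: "R \<subseteq> - A" "infinite R" "\<And>F. F \<in> K \<Longrightarrow> eventually (\<lambda>x. x \<notin> R) F"
      using infinite_subset_avoiding_ultrafilters[OF K(2) _ A] by metis
    \<comment> \<open>\<open>C'\<close> must equal \<open>C\<close> on \<open>A\<close> to
      strengthen the condition and follows \<open>D\<close> elsewhere; on \<open>A\<close> the two
      differ only finitely.\<close>
    define C' where "C' = (C \<inter> A) \<union> (D - A)"
    have "cylinder (- R) C' \<subseteq> star_indicator -` U"
    proof
      fix D' assume D': "D' \<in> cylinder (- R) C'"
      have "finite ((sym_diff D' C' \<inter> - R) \<union> (sym_diff D C \<inter> A))"
        using D(1) D' by (auto simp: cylinder_def)
      then have fin: "finite (sym_diff D' D \<inter> - R)"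
        by (rule rev_finite_subset) (auto simp: C'_def)
      have "star_indicator D' F = star_indicator D F" if F: "F \<in> K" for F
      proof -
        have uF: "ultrafilter F" "F \<notin> range omega_point"
          using F K(1) by (auto simp: topspace_omega_star)
        \<comment> \<open>An ultrafilter concentrated at \<open>n\<close> would be
          \<open>omega_point n\<close>. So \<open>F\<close> ignores the finite error outside
          \<open>R\<close>.\<close>
        have "eventually (\<lambda>x. x \<noteq> n) F" for n
        proof (rule ccontr)
          assume "\<not> ?thesis"
          then have n: "eventually (\<lambda>x. x = n) F"
            using ultrafilter_not_eventually[OF uF(1), of "\<lambda>x. x \<noteq> n"] by simp
          then have "F \<le> omega_point n"
            by (simp add: omega_point_def le_principal)
          moreover have "omega_point n \<le> F"
          proof (rule filter_leI)
            fix P assume "eventually P F"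
            with n have "eventually (\<lambda>x. P n) F" by eventually_elim simp
            then show "eventually P (omega_point n)"
              using uF(1) by (auto simp: omega_point_def eventually_principal ultrafilter_def eventually_const_iff)
          qed
          ultimately show False using uF(2) by (metis order_antisym rangeI)
        qed
        then have "eventually (\<lambda>x. \<forall>n\<in>sym_diff D' D \<inter> - R. x \<noteq> n) F"
          using fin by (simp add: eventually_ball_finite)
        then have "eventually (\<lambda>x. x \<in> D' \<longleftrightarrow> x \<in> D) F"
          using R(3)[OF F] by eventually_elim blast
        then have "eventually (\<lambda>x. x \<in> D') F \<longleftrightarrow> eventually (\<lambda>x. x \<in> D) F"
          by (rule eventually_subst)
        then show ?thesis
          using F K(1) by (subst star_indicator_eq_iff) auto
      qed
      then show "D' \<in> star_indicator -` U"
        using K(3) star_indicator_in_Cp by auto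
    qed
    then show ?thesis using R
      by (intro exI[of _ "- R"] exI[of _ C']) (auto simp: decides_def C'_def)
  qed
qed

text \<open>By minimality of \<open>C_sets\<close>, it suffices that the sets with decidable
  preimage form a Souslin-closed sigma-algebra containing the open sets.\<close>

lemma decidable_C_set:
  assumes "Y \<in> C_sets (Cp omega_star)"
  shows "decidable (star_indicator -` Y)"
proof -
  let ?X = "topspace (Cp omega_star)"
  let ?M = "{Y \<in> Pow ?X. decidable (star_indicator -` Y)}"
  have "C_sets (Cp omega_star) \<subseteq> ?M"
    unfolding C_sets_def
  proof (rule Inter_lower, rule CollectI, intro conjI allI impI)
    show "{U. openin (Cp omega_star) U} \<subseteq> ?M"
      using decidable_open by (auto dest: openin_subset)
    show "sigma_algebra ?X ?M"
      unfolding sigma_algebra_iff2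
    proof (intro conjI ballI allI impI)
      show "{} \<in> ?M" using decidable_open[OF openin_empty] by simp
    next
      fix Y assume "Y \<in> ?M"
      then show "?X - Y \<in> ?M"
        using star_indicator_in_Cp
        by (auto intro: decidable_combination[of "\<lambda>_. star_indicator -` Y"])
    next
      fix Y :: "nat \<Rightarrow> (nat filter \<Rightarrow> real) set" assume "range Y \<subseteq> ?M"
      then have Y: "Y n \<subseteq> ?X" "decidable (star_indicator -` Y n)" for n by auto
      have "decidable (star_indicator -` \<Union>(range Y))"
        by (rule decidable_combination[of "\<lambda>n. star_indicator -` Y n", OF Y(2)]) simp
      with Y(1) show "\<Union>(range Y) \<in> ?M" by auto
    qed auto
  next
    fix Y :: "nat list \<Rightarrow> (nat filter \<Rightarrow> real) set" assume "range Y \<subseteq> ?M"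
    then have Y: "Y s \<subseteq> ?X" "decidable (star_indicator -` Y s)" for s by auto
    have "decidable (star_indicator -` souslin Y)"
    \<comment> \<open>Finite sequences are countable, so \<open>from_nat\<close> turns the Souslin
      scheme into a sequence.\<close>
    proof (rule decidable_combination[of "\<lambda>n. star_indicator -` Y (from_nat n)"])
      fix D D'
      assume *: "\<And>n. D \<in> star_indicator -` Y (from_nat n) \<longleftrightarrow> D' \<in> star_indicator -` Y (from_nat n)"
      have "star_indicator D \<in> Y s \<longleftrightarrow> star_indicator D' \<in> Y s" for s
        using *[of "to_nat s"] by simp
      then show "D \<in> star_indicator -` souslin Y \<longleftrightarrow> D' \<in> star_indicator -` souslin Y"
        by (simp add: souslin_def)
    qed (rule Y(2))
    with Y(1) show "souslin Y \<in> ?M" unfolding souslin_def by auto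
  qed
  with assms show ?thesis by blast
qed

section \<open>Distinct indicators that the given sets do not separate\<close>

text \<open>An ultrafilter refining the cofinite filter and containing the symmetric difference is
  free and contains exactly one of \<open>D\<close> and \<open>D'\<close>.\<close>

lemma star_indicator_neq:
  assumes "infinite (sym_diff D D')"
  shows "star_indicator D \<noteq> star_indicator D'"
proof -
  let ?G = "inf cofinite (principal (sym_diff D D'))"
  have "?G \<noteq> bot"
    using assms
    by (simp add: trivial_limit_def eventually_inf_principal eventually_cofinite Un_def set_diff_eq)
  then obtain F where F: "F \<le> ?G" "ultrafilter F"
    using ultrafilter_exists by blast
  have "F \<noteq> omega_point n" for n
  proof
    assume "F = omega_point n"
    moreover have "eventually (\<lambda>x. x \<noteq> n) F"
      using F(1) by (rule filter_leD) (simp add: eventually_inf_principal eventually_cofinite)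
    ultimately show False by (simp add: omega_point_def eventually_principal)
  qed
  then have top: "F \<in> topspace omega_star"
    using F(2) by (auto simp: topspace_omega_star)
  have "eventually (\<lambda>n. n \<in> sym_diff D D') F"
    using F(1) by (rule filter_leD) (simp add: eventually_inf_principal)
  then have "eventually (\<lambda>n. n \<in> D') F \<longleftrightarrow> eventually (\<lambda>n. n \<notin> D) F"
    by (intro eventually_subst) (auto elim: eventually_mono)
  then have "star_indicator D F \<noteq> star_indicator D' F"
    using ultrafilter_not_eventually[OF F(2)] top by (auto simp: star_indicator_eq_iff)
  then show ?thesis by metis
qed

theorem theorem4p1:
  fixes Y :: "nat \<Rightarrow> (nat filter \<Rightarrow> real) set"
  assumes "\<And>n. Y n \<in> C_sets (Cp omega_star)"
  shows "\<exists>g1 \<in> topspace (Cp omega_star). \<exists>g2 \<in> topspace (Cp omega_star).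
           g1 \<noteq> g2 \<and> (\<forall>n. g1 \<in> Y n \<longleftrightarrow> g2 \<in> Y n)"
proof -
  \<comment> \<open>The fusion starts from the domain \<open>{}\<close>, where nothing is
    fixed.\<close>
  obtain A C where A: "infinite (- A)" and d: "\<And>n. decides A C (star_indicator -` Y n)"
    using decidable_sequence[of "\<lambda>n. star_indicator -` Y n" "{}"] decidable_C_set[OF assms]
    by (auto simp: infinite_UNIV_nat)
  \<comment> \<open>\<open>D\<close> flips \<open>C\<close> at every free coordinate: it stays in
    the cylinder but differs from \<open>C\<close> on the infinite set \<open>- A\<close>.\<close>
  define D where "D = sym_diff C (- A)"
  have "C \<in> cylinder A C" by (simp add: cylinder_def)
  moreover have "sym_diff D C \<inter> A = {}" by (auto simp: D_def)
  then have "D \<in> cylinder A C" by (simp add: cylinder_def)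
  ultimately have "star_indicator C \<in> Y n \<longleftrightarrow> star_indicator D \<in> Y n" for n
    using d[of n] by (auto simp: decides_def)
  moreover have "sym_diff C D = - A" by (auto simp: D_def)
  then have "star_indicator C \<noteq> star_indicator D"
    using A star_indicator_neq by metis
  ultimately show ?thesis using star_indicator_in_Cp by blast
qed

end
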